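(* For any $n\ge 1$, the $h^*$-polynomial of the order polytope of the crown poset $\mathcal{C}_{2n}$ is $$h^*(\mathcal{O}(\mathcal{C}_{2n}),t)=\sum_{\sigma\in \mathrm{CA}_{2n}} t^{\mathrm{cswap}(\sigma)}.$$
   Context: The crown poset $\mathcal{C}_{2n}$ is the poset on $[2n]$ with cover relations $1\prec 2\succ 3\prec\cdots\succ 2n-1\prec 2n\succ 1$ (for $n=1$ it is the chain $1\prec 2$). The order polytope of a poset $P=([d],\preceq)$ is $\mathcal{O}(P)=\{x\in[0,1]^d : x_i\le x_j \text{ whenever } i\preceq j\}$. For a $d$-dimensional lattice polytope $\mathfrak{p}\subseteq\mathbb{R}^d$, its $h^*$-polynomial $h^*(\mathfrak{p},t)$ is the polynomial of degree at most $d$ defined by $1+\sum_{k\ge1}\#(k\mathfrak{p}\cap\mathbb{Z}^d)\,t^k = h^*(\mathfrak{p},t)/(1-t)^{d+1}$. A permutation $\sigma=\sigma_1\cdots\sigma_{2n}\in S_{2n}$ is cyclically alternating if $\sigma_1<\sigma_2>\sigma_3<\cdots>\sigma_{2n-1}<\sigma_{2n}>\sigma_1$; $\mathrm{CA}_{2n}$ is the set of these. For $\sigma\in\mathrm{CA}_{2n}$, $\mathrm{cswap}(\sigma)$ is the number of $i<2n$ (with $i\geq 1$) such that $\sigma^{-1}(i)>\sigma^{-1}(i+1)+1$. *)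

theory Defs
  imports
    Complex_Main
    "HOL-Library.FuncSet"
    "HOL-Combinatorics.Permutations"
    "HOL-Computational_Algebra.Polynomial_FPS"
begin

text \<open>
  The space \<open>\<real>\<^sup>d\<close> is represented by \<open>{1..d} \<rightarrow>\<^sub>E UNIV\<close>, so that \<open>d\<close> can be a term;
  points are extensional functions and hence determined by their \<open>d\<close> coordinates.
  A poset on \<open>{1..d}\<close> is represented by its order relation, with \<open>(i, j)\<close> standing
  for \<open>i \<preceq> j\<close>.
\<close>

definition crown_covers :: "nat \<Rightarrow> nat rel" where
  "crown_covers n =
     {(2 * k - 1, 2 * k) |k. k \<in> {1..n}} \<union> {(2 * k + 1, 2 * k) |k. k \<in> {1..<n}} \<union> {(1, 2 * n)}"

definition crown_order :: "nat \<Rightarrow> nat rel" where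
  "crown_order n = Id_on {1..2 * n} \<union> (crown_covers n)\<^sup>+"

definition order_polytope :: "nat \<Rightarrow> nat rel \<Rightarrow> (nat \<Rightarrow> real) set" where
  "order_polytope d r = {x \<in> {1..d} \<rightarrow>\<^sub>E {0..1}. \<forall>(i, j) \<in> r. x i \<le> x j}"

definition dilate :: "nat \<Rightarrow> nat \<Rightarrow> (nat \<Rightarrow> real) set \<Rightarrow> (nat \<Rightarrow> real) set" where
  "dilate d k p = (\<lambda>x. \<lambda>i\<in>{1..d}. real k * x i) ` p"

definition ehrhart_series :: "nat \<Rightarrow> (nat \<Rightarrow> real) set \<Rightarrow> real fps" where
  "ehrhart_series d p =
     Abs_fps (\<lambda>k. if k = 0 then 1 else real (card (dilate d k p \<inter> ({1..d} \<rightarrow>\<^sub>E \<int>))))"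

text \<open>
  The description is only meaningful if such a polynomial exists, as it does for
  \<open>d\<close>-dimensional lattice polytopes; it is then unique.
\<close>

definition hstar :: "nat \<Rightarrow> (nat \<Rightarrow> real) set \<Rightarrow> real poly" where
  "hstar d p =
     (THE h. degree h \<le> d \<and> ehrhart_series d p = fps_of_poly h / (1 - fps_X) ^ (d + 1))"

definition cyc_alternating :: "nat \<Rightarrow> (nat \<Rightarrow> nat) set" where
  "cyc_alternating n =
     {\<sigma>. \<sigma> permutes {1..2 * n} \<and>
         (\<forall>k\<in>{1..n}. \<sigma> (2 * k - 1) < \<sigma> (2 * k)) \<and>
         (\<forall>k\<in>{1..<n}. \<sigma> (2 * k) > \<sigma> (2 * k + 1)) \<and>
         \<sigma> (2 * n) > \<sigma> 1}"

definition cswap :: "nat \<Rightarrow> (nat \<Rightarrow> nat) \<Rightarrow> nat" where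
  "cswap n \<sigma> = card {i \<in> {1..<2 * n}. inv \<sigma> i > inv \<sigma> (i + 1) + 1}"

end

theory Submission imports Defs begin

text \<open>
  The statistic \<open>cswap\<close> is a descent statistic in disguise. Relabel the crown by
  \<open>\<omega>\<close>, the involution that exchanges \<open>2k\<close> and \<open>2k + 1\<close> for \<open>1 \<le> k < n\<close> and fixes \<open>1\<close>
  and \<open>2n\<close>. Then \<open>\<omega>\<close> is a natural labelling: it increases along every cover relation.
  Cyclically alternating permutations are exactly the linear extensions \<open>\<sigma>\<close> of the crown, and if
  \<open>a\<close> and \<open>b\<close> occupy consecutive places of \<open>\<sigma>\<close> (\<open>\<sigma> b = \<sigma> a + 1\<close>), then \<open>\<omega> a > \<omega> b\<close>
  holds precisely when \<open>a > b + 1\<close>. Indeed \<open>\<omega>\<close> changes the order of no pair except \<open>2k, 2k + 1\<close>.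
  Among the pairs at distance one, \<open>b\<close> cannot be covered by \<open>a\<close>, so the only possible case with
  \<open>a = b + 1\<close> is \<open>a = 2k + 1\<close>, \<open>b = 2k\<close>, where \<open>\<omega>\<close> removes the descent; and \<open>\<omega>\<close> would create
  a descent only for \<open>a = 2k\<close>, \<open>b = 2k + 1\<close>, which is excluded. This is
  \<open>cswap_eq_descents\<close>.

  It remains to apply Stanley's theorem that the \<open>h\<^sup>*\<close>-polynomial of an order polytope is the
  descent enumerator of the linear extensions for any natural labelling
  (\<open>hstar_order_polytope\<close>). Lattice points of the \<open>k\<close>-th dilate are the order-preserving maps
  \<open>f\<close> into \<open>{0..k}\<close>. Sorting the elements by \<open>(f, \<omega>)\<close> lexicographically attaches to each \<open>f\<close> a
  unique linear extension \<open>\<sigma>\<close>, such that \<open>f\<close> weakly increases along \<open>\<sigma>\<close> and strictly increases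
  at the descents. For fixed \<open>\<sigma>\<close> these \<open>f\<close> are chains in \<open>{0..k}\<close> with prescribed strict steps,
  and each further element of the chain multiplies the generating function over \<open>k\<close> by
  \<open>1 / (1 - X)\<close>, with an extra factor \<open>X\<close> if the step to it is strict
  (\<open>chain_series_Suc\<close>). So \<open>\<sigma>\<close> contributes \<open>X ^ m / (1 - X) ^ (d + 1)\<close>, where \<open>m\<close> is its number of descents.
\<close>

section \<open>Chains with prescribed strict steps\<close>

definition step_chains :: "(nat \<Rightarrow> bool) \<Rightarrow> nat \<Rightarrow> nat \<Rightarrow> (nat \<Rightarrow> nat) set" where
  "step_chains s d k = {g \<in> {1..d} \<rightarrow>\<^sub>E {0..k}.
     \<forall>i\<in>{1..<d}. g i \<le> g (Suc i) \<and> (s i \<longrightarrow> g i < g (Suc i))}"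

lemma finite_chains: "finite (step_chains s d k)"
  unfolding step_chains_def by (rule finite_subset[OF _ finite_PiE[of "{1..d}" "\<lambda>_. {0..k}"]]) auto

lemma chains_le_last:
  assumes "g \<in> step_chains s d k" "i \<in> {1..d}"
  shows "g i \<le> g d"
proof -
  have "i \<le> d" "1 \<le> i" using assms(2) by auto
  then show ?thesis
  proof (induction i rule: inc_induct)
    case base
    then show ?case by simp
  next
    case (step m)
    have "g m \<le> g (Suc m)" using assms(1) step unfolding step_chains_def by auto
    then show ?case using step by auto
  qed
qed

text \<open>
  Because chains increase, the condition on the last step bounds all earlier elements at once: by
  \<open>k\<close>, or by \<open>k - 1\<close> if that step is strict.
\<close>

lemma bij_betw_chains_ending_at:
  assumes "s d \<Longrightarrow> 1 \<le> d \<and> m + 1 = k" "\<not> s d \<Longrightarrow> m = k"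
  shows "bij_betw (\<lambda>g. g(Suc d := k)) (step_chains s d m) {g \<in> step_chains s (Suc d) k. g (Suc d) = k}"
proof (rule bij_betw_byWitness[where f' = "\<lambda>g. g(Suc d := undefined)"])
  show "\<forall>g\<in>step_chains s d m. (g(Suc d := k))(Suc d := undefined) = g"
    by (auto simp: step_chains_def PiE_def extensional_def fun_eq_iff)
  show "\<forall>g\<in>{g \<in> step_chains s (Suc d) k. g (Suc d) = k}. (g(Suc d := undefined))(Suc d := k) = g"
    by (auto simp: fun_eq_iff)
  show "(\<lambda>g. g(Suc d := k)) ` step_chains s d m \<subseteq> {g \<in> step_chains s (Suc d) k. g (Suc d) = k}"
  proof safe
    fix g assume g: "g \<in> step_chains s d m"
    have mk: "m \<le> k" "s d \<Longrightarrow> m < k" using assms by (cases "s d"; force)+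
    have b: "g i \<le> m" if "i \<in> {1..d}" for i using g that by (auto simp: step_chains_def)
    have "g i \<le> k" if "i \<in> {1..d}" for i
      using b[OF that] mk(1) by simp
    moreover have "g d < k" if "s d"
      using b[of d] mk(2)[OF that] assms(1)[OF that] by simp
    moreover have "g i = undefined" if "i \<notin> {1..d}" for i
      using g that by (auto simp: step_chains_def PiE_def extensional_def)
    ultimately show "g(Suc d := k) \<in> step_chains s (Suc d) k"
      using g unfolding step_chains_def
      by (auto simp: PiE_def extensional_def Pi_def less_Suc_eq)
  qed simp
  show "(\<lambda>g. g(Suc d := undefined)) ` {g \<in> step_chains s (Suc d) k. g (Suc d) = k} \<subseteq> step_chains s d m"
  proof (rule image_subsetI)
    fix g assume "g \<in> {g \<in> step_chains s (Suc d) k. g (Suc d) = k}"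
    then have g: "g \<in> step_chains s (Suc d) k" and k: "k = g (Suc d)" by auto
    have c: "g i \<le> g (Suc i) \<and> (s i \<longrightarrow> g i < g (Suc i))" if "i \<in> {1..<d}" for i
      using g that by (auto simp: step_chains_def)
    \<comment> \<open>Only the last step needs care: when it is strict, the bound drops from \<open>k\<close> to \<open>k - 1\<close>.\<close>
    have b: "g i \<le> m" if i: "i \<in> {1..d}" for i
    proof (cases "s d")
      case False
      then show ?thesis using chains_le_last[OF g, of i] i assms k by auto
    next
      case True
      have "(g(Suc d := undefined)) \<in> step_chains s d k"
        using g unfolding step_chains_def by (auto simp: PiE_def extensional_def Pi_def)
      from chains_le_last[OF this i] i have "g i \<le> g d" by auto
      also have "g d < g (Suc d)" using g True i by (auto simp: step_chains_def)
      finally show ?thesis using assms True k by auto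
    qed
    show "g(Suc d := undefined) \<in> step_chains s d m"
      using g b c unfolding step_chains_def
      by (auto simp: PiE_def extensional_def Pi_def)
  qed
qed

text \<open>
  The first element of a chain has no predecessor to exceed. With \<open>\<not> s 0\<close> the passage from length
  \<open>0\<close> to length \<open>1\<close> follows the same recursion as the later ones.
\<close>

lemma card_chains_ending_at:
  assumes "\<not> s 0"
  shows "card {g \<in> step_chains s (Suc d) k. g (Suc d) = k} =
    (if s d then if k = 0 then 0 else card (step_chains s d (k - 1)) else card (step_chains s d k))"
proof -
  have d: "1 \<le> d" if "s d" using assms that by (cases d) auto
  show ?thesis
  proof (cases "s d \<and> k = 0")
    case True
    have "{g \<in> step_chains s (Suc d) k. g (Suc d) = k} = {}"
      using True d by (force simp: step_chains_def)
    then have "card {g \<in> step_chains s (Suc d) k. g (Suc d) = k} = 0" by (simp only: card.empty)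
    with True show ?thesis by simp
  next
    case False
    have "bij_betw (\<lambda>g. g(Suc d := k)) (step_chains s d (if s d then k - 1 else k))
        {g \<in> step_chains s (Suc d) k. g (Suc d) = k}"
      by (rule bij_betw_chains_ending_at) (use False d in auto)
    from bij_betw_same_card[OF this] False show ?thesis by auto
  qed
qed

lemma card_chains_Suc_bound:
  "card (step_chains s (Suc d) (Suc k)) =
     card (step_chains s (Suc d) k) + card {g \<in> step_chains s (Suc d) (Suc k). g (Suc d) = Suc k}"
proof -
  have *: "g \<in> step_chains s (Suc d) k \<longleftrightarrow> g \<in> step_chains s (Suc d) (Suc k) \<and> g (Suc d) \<noteq> Suc k" for g
  proof
    assume R: "g \<in> step_chains s (Suc d) (Suc k) \<and> g (Suc d) \<noteq> Suc k"
    then have "g (Suc d) \<le> k" by (force simp: step_chains_def PiE_def Pi_def le_Suc_eq)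
    then have "g i \<le> k" if "i \<in> {1..Suc d}" for i
      using chains_le_last[of g s "Suc d" "Suc k" i] that R by force
    with R show "g \<in> step_chains s (Suc d) k" by (auto simp: step_chains_def PiE_def Pi_def)
  next
    assume "g \<in> step_chains s (Suc d) k"
    then show "g \<in> step_chains s (Suc d) (Suc k) \<and> g (Suc d) \<noteq> Suc k"
      unfolding step_chains_def PiE_def Pi_def by (force intro: le_SucI)
  qed
  have "step_chains s (Suc d) (Suc k) =
      step_chains s (Suc d) k \<union> {g \<in> step_chains s (Suc d) (Suc k). g (Suc d) = Suc k}"
    using * by auto
  moreover have "step_chains s (Suc d) k \<inter> {g \<in> step_chains s (Suc d) (Suc k). g (Suc d) = Suc k} = {}"
    using * by auto
  ultimately show ?thesis
    by (metis (no_types, lifting) card_Un_disjoint finite_Un finite_chains)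
qed

definition chain_series :: "(nat \<Rightarrow> bool) \<Rightarrow> nat \<Rightarrow> real fps" where
  "chain_series s d = Abs_fps (\<lambda>k. real (card (step_chains s d k)))"

text \<open>
  Multiplying by \<open>1 - X\<close> takes differences in the bound \<open>k\<close>, which leaves the chains ending exactly
  at \<open>k\<close>; these are shorter chains bounded by \<open>k\<close> or, after a strict step, by \<open>k - 1\<close>.
\<close>

lemma chain_series_Suc:
  assumes "\<not> s 0"
  shows "(1 - fps_X) * chain_series s (Suc d) =
    (if s d then fps_X else 1) * chain_series s d"
proof (rule fps_ext)
  fix k
  show "fps_nth ((1 - fps_X) * chain_series s (Suc d)) k =
      fps_nth ((if s d then fps_X else 1) * chain_series s d) k"
  proof (cases k)
    case 0
    have "{g \<in> step_chains s (Suc d) 0. g (Suc d) = 0} = step_chains s (Suc d) 0"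
      by (auto simp: step_chains_def PiE_def Pi_def)
    with card_chains_ending_at[of s d 0, OF assms] 0 show ?thesis
      by (auto simp: chain_series_def left_diff_distrib)
  next
    case (Suc l)
    with card_chains_ending_at[of s d "Suc l", OF assms] card_chains_Suc_bound[of s d l]
    show ?thesis by (auto simp: chain_series_def left_diff_distrib)
  qed
qed

lemma chain_series_eq:
  assumes "\<not> s 0"
  shows "(1 - fps_X) ^ (d + 1) * chain_series s d = fps_X ^ card {i \<in> {1..<d}. s i}"
proof (induction d)
  case 0
  have "chain_series s 0 = Abs_fps (\<lambda>_. 1)"
    by (simp add: chain_series_def step_chains_def)
  then show ?case
    by (auto simp: fps_eq_iff left_diff_distrib)
next
  case (Suc d)
  have "{i \<in> {1..<Suc d}. s i} = (if s d then insert d {i \<in> {1..<d}. s i} else {i \<in> {1..<d}. s i})"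
    using assms by (cases d) (auto simp: less_Suc_eq)
  then have c: "card {i \<in> {1..<Suc d}. s i} = (if s d then 1 else 0) + card {i \<in> {1..<d}. s i}"
    by auto
  have "(1 - fps_X) ^ (Suc d + 1) * chain_series s (Suc d) =
      (1 - fps_X) ^ (d + 1) * ((1 - fps_X) * chain_series s (Suc d))"
    by (simp add: algebra_simps)
  also have "\<dots> = (if s d then fps_X else 1) * ((1 - fps_X) ^ (d + 1) * chain_series s d)"
    unfolding chain_series_Suc[of s, OF assms] by (rule mult.left_commute)
  also have "\<dots> = fps_X ^ card {i \<in> {1..<Suc d}. s i}"
    unfolding Suc.IH c by (simp add: power_add)
  finally show ?case .
qed

section \<open>Sorting by an injective key\<close>

text \<open>
  If the keys increase along the places of \<open>\<sigma>\<close>, then the elements placed no later than \<open>a\<close> are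
  those with key at most that of \<open>a\<close>. This formula yields both the uniqueness of the
  sorting permutation and its monotonicity in the key.
\<close>

lemma strict_mono_permutation_eq_rank:
  assumes \<sigma>: "\<sigma> permutes {1..d}"
    and step: "\<And>i. i \<in> {1..<d} \<Longrightarrow> \<kappa> (inv \<sigma> i) < (\<kappa> (inv \<sigma> (Suc i)) :: nat)"
    and a: "a \<in> {1..d}"
  shows "\<sigma> a = card {b \<in> {1..d}. \<kappa> b \<le> \<kappa> a}"
proof -
  have less: "\<kappa> (inv \<sigma> i) < \<kappa> (inv \<sigma> j)" if "1 \<le> i" "i < j" "j \<le> d" for i j
    using that(2,3)
  proof (induction j)
    case (Suc j)
    have "\<kappa> (inv \<sigma> j) < \<kappa> (inv \<sigma> (Suc j))" using step Suc that by auto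
    with Suc show ?case by (cases "i = j") auto
  qed simp
  have inv: "inv \<sigma> (\<sigma> x) = x" for x using permutes_inverses(2)[OF \<sigma>] .
  have rng: "\<sigma> x \<in> {1..d}" if "x \<in> {1..d}" for x using permutes_in_image[OF \<sigma>] that by blast
  have iff: "\<sigma> b \<le> \<sigma> a \<longleftrightarrow> \<kappa> b \<le> \<kappa> a" if b: "b \<in> {1..d}" for b
    using less[of "\<sigma> a" "\<sigma> b"] less[of "\<sigma> b" "\<sigma> a"] rng[OF a] rng[OF b] inv
    by (cases "\<sigma> a" "\<sigma> b" rule: linorder_cases) (auto, metis order_refl)
  have "{1..\<sigma> a} = \<sigma> ` {b \<in> {1..d}. \<sigma> b \<le> \<sigma> a}"
  proof -
    have "\<sigma> ` {1..d} = {1..d}" by (rule permutes_image[OF \<sigma>])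
    with rng[OF a] have "{1..\<sigma> a} = {j \<in> \<sigma> ` {1..d}. j \<le> \<sigma> a}" by auto
    moreover have "{j \<in> \<sigma> ` {1..d}. j \<le> \<sigma> a} = \<sigma> ` {b \<in> {1..d}. \<sigma> b \<le> \<sigma> a}"
      by auto
    ultimately show ?thesis by (rule trans)
  qed
  moreover have "\<sigma> a = card {1..\<sigma> a}" by simp
  ultimately have "\<sigma> a = card (\<sigma> ` {b \<in> {1..d}. \<sigma> b \<le> \<sigma> a})" by simp
  also have "\<dots> = card {b \<in> {1..d}. \<sigma> b \<le> \<sigma> a}"
    by (intro card_image inj_on_subset[OF permutes_inj[OF \<sigma>]]) auto
  also have "{b \<in> {1..d}. \<sigma> b \<le> \<sigma> a} = {b \<in> {1..d}. \<kappa> b \<le> \<kappa> a}" using iff by auto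
  finally show ?thesis .
qed

lemma ex1_sorting_permutation:
  assumes inj: "inj_on (\<kappa> :: nat \<Rightarrow> nat) {1..d}"
  shows "\<exists>!\<sigma>. \<sigma> permutes {1..d} \<and> (\<forall>i\<in>{1..<d}. \<kappa> (inv \<sigma> i) < \<kappa> (inv \<sigma> (Suc i)))"
proof (rule ex_ex1I)
  define \<rho> where "\<rho> a = (if a \<in> {1..d} then card {b \<in> {1..d}. \<kappa> b \<le> \<kappa> a} else a)" for a
  have less: "\<rho> a < \<rho> b" if "a \<in> {1..d}" "b \<in> {1..d}" "\<kappa> a < \<kappa> b" for a b
  proof -
    have "{c \<in> {1..d}. \<kappa> c \<le> \<kappa> a} \<subset> {c \<in> {1..d}. \<kappa> c \<le> \<kappa> b}"
    proof
      show "{c \<in> {1..d}. \<kappa> c \<le> \<kappa> a} \<subseteq> {c \<in> {1..d}. \<kappa> c \<le> \<kappa> b}" using that by auto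
      have "b \<in> {c \<in> {1..d}. \<kappa> c \<le> \<kappa> b}" "b \<notin> {c \<in> {1..d}. \<kappa> c \<le> \<kappa> a}" using that by auto
      then show "{c \<in> {1..d}. \<kappa> c \<le> \<kappa> a} \<noteq> {c \<in> {1..d}. \<kappa> c \<le> \<kappa> b}" by metis
    qed
    then have "card {c \<in> {1..d}. \<kappa> c \<le> \<kappa> a} < card {c \<in> {1..d}. \<kappa> c \<le> \<kappa> b}"
      by (intro psubset_card_mono) auto
    then show ?thesis using that unfolding \<rho>_def by simp
  qed
  have "inj_on \<rho> {1..d}"
  proof (rule inj_onI)
    fix a b assume "a \<in> {1..d}" "b \<in> {1..d}" "\<rho> a = \<rho> b"
    then show "a = b" using less[of a b] less[of b a] inj_onD[OF inj, of a b]
      by (metis less_irrefl linorder_neqE_nat)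
  qed
  moreover have "\<rho> ` {1..d} \<subseteq> {1..d}"
  proof safe
    fix a assume a: "a \<in> {1..d}"
    have "card {b \<in> {1..d}. \<kappa> b \<le> \<kappa> a} \<le> card {1..d}" by (rule card_mono) auto
    moreover have "0 < card {b \<in> {1..d}. \<kappa> b \<le> \<kappa> a}" using a by (auto simp: card_gt_0_iff)
    ultimately show "\<rho> a \<in> {1..d}" using a by (auto simp: \<rho>_def)
  qed
  ultimately have "bij_betw \<rho> {1..d} {1..d}"
    by (metis bij_betw_def endo_inj_surj finite_atLeastAtMost)
  then have perm: "\<rho> permutes {1..d}"
    by (rule bij_imp_permutes) (auto simp: \<rho>_def)
  have "\<kappa> (inv \<rho> i) < \<kappa> (inv \<rho> (Suc i))" if i: "i \<in> {1..<d}" for i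
  proof (rule ccontr)
    assume n: "\<not> ?thesis"
    have in': "inv \<rho> i \<in> {1..d}" "inv \<rho> (Suc i) \<in> {1..d}"
      using permutes_in_image[OF permutes_inv[OF perm]] i by auto
    have r: "\<rho> (inv \<rho> i) = i" "\<rho> (inv \<rho> (Suc i)) = Suc i"
      using permutes_inverses(1)[OF perm] by auto
    have "\<kappa> (inv \<rho> (Suc i)) \<noteq> \<kappa> (inv \<rho> i)"
      using inj_onD[OF inj _ in'] r by fastforce
    then show False using less[OF in'(2,1)] n r by auto
  qed
  with perm show "\<exists>\<sigma>. \<sigma> permutes {1..d} \<and> (\<forall>i\<in>{1..<d}. \<kappa> (inv \<sigma> i) < \<kappa> (inv \<sigma> (Suc i)))"
    by blast
next
  fix \<sigma> \<tau>
  assume "\<sigma> permutes {1..d} \<and> (\<forall>i\<in>{1..<d}. \<kappa> (inv \<sigma> i) < \<kappa> (inv \<sigma> (Suc i)))"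
    and "\<tau> permutes {1..d} \<and> (\<forall>i\<in>{1..<d}. \<kappa> (inv \<tau> i) < \<kappa> (inv \<tau> (Suc i)))"
  then have *: "\<sigma> permutes {1..d}" "\<tau> permutes {1..d}" "\<And>a. a \<in> {1..d} \<Longrightarrow> \<sigma> a = \<tau> a"
    using strict_mono_permutation_eq_rank[of \<sigma> d \<kappa>] strict_mono_permutation_eq_rank[of \<tau> d \<kappa>] by auto
  then show "\<sigma> = \<tau>" by (metis ext permutes_not_in)
qed

section \<open>Order-preserving maps and linear extensions\<close>

definition order_maps :: "nat \<Rightarrow> nat rel \<Rightarrow> nat \<Rightarrow> (nat \<Rightarrow> nat) set" where
  "order_maps d r k = {f \<in> {1..d} \<rightarrow>\<^sub>E {0..k}. \<forall>(i, j) \<in> r. f i \<le> f j}"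

text \<open>
  A linear extension sends each element to its place, so its inverse is the word listing the
  elements in order. For a permutation, \<open>\<le>\<close> amounts to strict increase on distinct elements.
\<close>

definition linear_extensions :: "nat \<Rightarrow> nat rel \<Rightarrow> (nat \<Rightarrow> nat) set" where
  "linear_extensions d r = {\<sigma>. \<sigma> permutes {1..d} \<and> (\<forall>(i, j) \<in> r. \<sigma> i \<le> \<sigma> j)}"

definition natural_labelling :: "nat \<Rightarrow> nat rel \<Rightarrow> (nat \<Rightarrow> nat) \<Rightarrow> bool" where
  "natural_labelling d r \<omega> \<longleftrightarrow> \<omega> permutes {1..d} \<and> (\<forall>(i, j) \<in> r. \<omega> i \<le> \<omega> j)"

definition descent :: "nat \<Rightarrow> (nat \<Rightarrow> nat) \<Rightarrow> (nat \<Rightarrow> nat) \<Rightarrow> nat \<Rightarrow> bool" where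
  "descent d \<omega> \<sigma> i \<longleftrightarrow> i \<in> {1..<d} \<and> \<omega> (inv \<sigma> (Suc i)) < \<omega> (inv \<sigma> i)"

text \<open>
  These maps are Stanley's \<open>\<sigma>\<close>-compatible ones: they are the \<open>f\<close> for which \<open>\<sigma>\<close> is
  the result of sorting by \<open>f\<close> and breaking ties by \<open>\<omega>\<close>.
\<close>

definition sorted_maps :: "nat \<Rightarrow> (nat \<Rightarrow> nat) \<Rightarrow> nat \<Rightarrow> (nat \<Rightarrow> nat) \<Rightarrow> (nat \<Rightarrow> nat) set" where
  "sorted_maps d \<omega> k \<sigma> = {f \<in> {1..d} \<rightarrow>\<^sub>E {0..k}. \<forall>i\<in>{1..<d}.
     f (inv \<sigma> i) \<le> f (inv \<sigma> (Suc i)) \<and> (descent d \<omega> \<sigma> i \<longrightarrow> f (inv \<sigma> i) < f (inv \<sigma> (Suc i)))}"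

lemma finite_linear_extensions: "finite (linear_extensions d r)"
  unfolding linear_extensions_def by (rule finite_subset[OF _ finite_permutations[of "{1..d}"]]) auto

lemma card_sorted_maps:
  assumes \<sigma>: "\<sigma> permutes {1..d}"
  shows "card (sorted_maps d \<omega> k \<sigma>) = card (step_chains (descent d \<omega> \<sigma>) d k)"
proof -
  note p = permutes_inverses[OF \<sigma>] permutes_in_image[OF \<sigma>] permutes_in_image[OF permutes_inv[OF \<sigma>]]
  have "bij_betw (\<lambda>f. \<lambda>i\<in>{1..d}. f (inv \<sigma> i)) (sorted_maps d \<omega> k \<sigma>) (step_chains (descent d \<omega> \<sigma>) d k)"
  proof (rule bij_betw_byWitness[where f' = "\<lambda>g. \<lambda>i\<in>{1..d}. g (\<sigma> i)"])
    show "\<forall>f\<in>sorted_maps d \<omega> k \<sigma>. (\<lambda>i\<in>{1..d}. (\<lambda>i\<in>{1..d}. f (inv \<sigma> i)) (\<sigma> i)) = f"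
      by (auto simp: sorted_maps_def fun_eq_iff p PiE_def extensional_def restrict_def
          simp del: atLeastAtMost_iff One_nat_def)
    show "\<forall>g\<in>step_chains (descent d \<omega> \<sigma>) d k. (\<lambda>i\<in>{1..d}. (\<lambda>i\<in>{1..d}. g (\<sigma> i)) (inv \<sigma> i)) = g"
      by (auto simp: step_chains_def fun_eq_iff p PiE_def extensional_def restrict_def
          simp del: atLeastAtMost_iff One_nat_def)
    show "(\<lambda>f. \<lambda>i\<in>{1..d}. f (inv \<sigma> i)) ` sorted_maps d \<omega> k \<sigma> \<subseteq> step_chains (descent d \<omega> \<sigma>) d k"
    proof safe
      fix f assume "f \<in> sorted_maps d \<omega> k \<sigma>"
      then show "(\<lambda>i\<in>{1..d}. f (inv \<sigma> i)) \<in> step_chains (descent d \<omega> \<sigma>) d k"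
        using p(4) unfolding sorted_maps_def step_chains_def by (auto simp: PiE_def Pi_def)
    qed
    show "(\<lambda>g. \<lambda>i\<in>{1..d}. g (\<sigma> i)) ` step_chains (descent d \<omega> \<sigma>) d k \<subseteq> sorted_maps d \<omega> k \<sigma>"
    proof safe
      fix g assume g: "g \<in> step_chains (descent d \<omega> \<sigma>) d k"
      have "(\<lambda>i\<in>{1..d}. g (\<sigma> i)) (inv \<sigma> i) = g i" if "i \<in> {1..d}" for i
        using p that by (simp del: atLeastAtMost_iff One_nat_def)
      then show "(\<lambda>i\<in>{1..d}. g (\<sigma> i)) \<in> sorted_maps d \<omega> k \<sigma>"
        using g p(3) unfolding sorted_maps_def step_chains_def by (auto simp: PiE_def Pi_def)
    qed
  qed
  then show ?thesis by (rule bij_betw_same_card)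
qed

text \<open>
  Reading \<open>x\<close> as the last digit in base \<open>d + 1\<close> and \<open>u\<close> as the number before it turns the
  lexicographic order on pairs into the order of natural numbers.
\<close>

lemma lexicographic_key_less_iff:
  assumes "x \<in> {1..d}" "y \<in> {1..d}"
  shows "u * Suc d + x < v * Suc d + y \<longleftrightarrow> u < v \<or> u = v \<and> x < (y :: nat)"
proof -
  have "u * Suc d + x < v * Suc d + y" if "u < v" "x \<le> d" for u v x y :: nat
  proof -
    have "Suc u * Suc d \<le> v * Suc d" using that by (intro mult_le_mono1) auto
    with that show ?thesis by (simp only: mult_Suc)
  qed
  from this[of u v x y] this[of v u y x] assms show ?thesis
    by (cases u v rule: linorder_cases) auto
qed

lemma sorted_maps_iff_key_increasing:
  assumes \<omega>: "\<omega> permutes {1..d}" and \<sigma>: "\<sigma> permutes {1..d}" and f: "f \<in> {1..d} \<rightarrow>\<^sub>E {0..k}"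
  shows "f \<in> sorted_maps d \<omega> k \<sigma> \<longleftrightarrow>
    (\<forall>i\<in>{1..<d}. f (inv \<sigma> i) * Suc d + \<omega> (inv \<sigma> i) <
       f (inv \<sigma> (Suc i)) * Suc d + \<omega> (inv \<sigma> (Suc i)))"
proof -
  have "f (inv \<sigma> i) * Suc d + \<omega> (inv \<sigma> i) < f (inv \<sigma> (Suc i)) * Suc d + \<omega> (inv \<sigma> (Suc i)) \<longleftrightarrow>
      f (inv \<sigma> i) \<le> f (inv \<sigma> (Suc i)) \<and> (descent d \<omega> \<sigma> i \<longrightarrow> f (inv \<sigma> i) < f (inv \<sigma> (Suc i)))"
    if i: "i \<in> {1..<d}" for i
  proof -
    have in': "\<omega> (inv \<sigma> i) \<in> {1..d}" "\<omega> (inv \<sigma> (Suc i)) \<in> {1..d}"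
      using permutes_in_image[OF \<omega>] permutes_in_image[OF permutes_inv[OF \<sigma>]] i by auto
    have "\<omega> (inv \<sigma> i) \<noteq> \<omega> (inv \<sigma> (Suc i))"
      using permutes_inj[OF \<omega>] permutes_inj[OF permutes_inv[OF \<sigma>]]
      by (metis injD n_not_Suc_n)
    then show ?thesis
      unfolding lexicographic_key_less_iff[OF in'] using i by (auto simp: descent_def)
  qed
  with f show ?thesis unfolding sorted_maps_def by auto
qed

lemma ex1_sorted_maps:
  assumes \<omega>: "\<omega> permutes {1..d}" and f: "f \<in> {1..d} \<rightarrow>\<^sub>E {0..k}"
  shows "\<exists>!\<sigma>. \<sigma> permutes {1..d} \<and> f \<in> sorted_maps d \<omega> k \<sigma>"
proof -
  have "inj_on (\<lambda>a. f a * Suc d + \<omega> a) {1..d}"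
  proof (rule inj_onI, rule ccontr)
    fix a b assume ab: "a \<in> {1..d}" "b \<in> {1..d}" "f a * Suc d + \<omega> a = f b * Suc d + \<omega> b" "a \<noteq> b"
    have "\<omega> a \<in> {1..d}" "\<omega> b \<in> {1..d}" using ab permutes_in_image[OF \<omega>] by auto
    from lexicographic_key_less_iff[OF this, of "f a" "f b"] lexicographic_key_less_iff[OF this(2,1), of "f b" "f a"]
    have "\<omega> a = \<omega> b" using ab(3) by auto
    then show False using permutes_inj[OF \<omega>] ab(4) by (auto dest: injD)
  qed
  from ex1_sorting_permutation[OF this] show ?thesis
    using sorted_maps_iff_key_increasing[OF \<omega> _ f] by (metis (mono_tags, lifting))
qed

lemma sorted_maps_subset_order_maps:
  assumes r: "r \<subseteq> {1..d} \<times> {1..d}" and \<sigma>: "\<sigma> \<in> linear_extensions d r"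
  shows "sorted_maps d \<omega> k \<sigma> \<subseteq> order_maps d r k"
proof
  fix f assume f: "f \<in> sorted_maps d \<omega> k \<sigma>"
  have p: "\<sigma> permutes {1..d}" using \<sigma> by (auto simp: linear_extensions_def)
  have mono: "f (inv \<sigma> i) \<le> f (inv \<sigma> j)" if "i \<le> j" "1 \<le> i" "j \<le> d" for i j
    using that
  proof (induction j rule: dec_induct)
    case (step j)
    have "f (inv \<sigma> j) \<le> f (inv \<sigma> (Suc j))" using f step by (auto simp: sorted_maps_def)
    then show ?case using step by auto
  qed simp
  have "f a \<le> f b" if ab: "(a, b) \<in> r" for a b
  proof -
    have "a \<in> {1..d}" "b \<in> {1..d}" using ab r by auto
    then have "\<sigma> a \<in> {1..d}" "\<sigma> b \<in> {1..d}" using permutes_in_image[OF p] by auto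
    moreover have "\<sigma> a \<le> \<sigma> b" using \<sigma> ab by (auto simp: linear_extensions_def)
    ultimately show ?thesis using mono[of "\<sigma> a" "\<sigma> b"] permutes_inverses[OF p] by auto
  qed
  then show "f \<in> order_maps d r k" using f by (auto simp: order_maps_def sorted_maps_def)
qed

text \<open>
  This is where the labelling has to be natural: both components of the key \<open>(f, \<omega>)\<close> increase
  weakly along \<open>r\<close>, hence so does the rank.
\<close>

lemma sorting_permutation_is_linear_extension:
  assumes r: "r \<subseteq> {1..d} \<times> {1..d}" and \<omega>: "natural_labelling d r \<omega>"
    and f: "f \<in> order_maps d r k" and \<sigma>: "\<sigma> permutes {1..d}" and s: "f \<in> sorted_maps d \<omega> k \<sigma>"
  shows "\<sigma> \<in> linear_extensions d r"
proof -
  have w: "\<omega> permutes {1..d}" using \<omega> by (simp add: natural_labelling_def)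
  have fE: "f \<in> {1..d} \<rightarrow>\<^sub>E {0..k}" using f by (simp add: order_maps_def)
  define \<kappa> where "\<kappa> a = f a * Suc d + \<omega> a" for a
  have rank: "\<sigma> a = card {b \<in> {1..d}. \<kappa> b \<le> \<kappa> a}" if "a \<in> {1..d}" for a
    using strict_mono_permutation_eq_rank[OF \<sigma>, of \<kappa> a] that
      s[unfolded sorted_maps_iff_key_increasing[OF w \<sigma> fE]] by (simp add: \<kappa>_def)
  have "\<sigma> a \<le> \<sigma> b" if ab: "(a, b) \<in> r" for a b
  proof -
    have "f a \<le> f b" "\<omega> a \<le> \<omega> b"
      using ab f \<omega> by (auto simp: order_maps_def natural_labelling_def)
    then have "\<kappa> a \<le> \<kappa> b" unfolding \<kappa>_def by (intro add_mono mult_le_mono1)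
    then have "card {c \<in> {1..d}. \<kappa> c \<le> \<kappa> a} \<le> card {c \<in> {1..d}. \<kappa> c \<le> \<kappa> b}"
      by (intro card_mono) auto
    then show ?thesis using rank ab r by (metis SigmaD1 SigmaD2 subsetD)
  qed
  with \<sigma> show ?thesis by (auto simp: linear_extensions_def)
qed

text \<open>
  The maps sorted by the various linear extensions partition the order-preserving maps, since
  lexicographic keys have no ties and so determine the sorting permutation.
\<close>

lemma card_order_maps:
  assumes r: "r \<subseteq> {1..d} \<times> {1..d}" and \<omega>: "natural_labelling d r \<omega>"
  shows "card (order_maps d r k) =
    (\<Sum>\<sigma>\<in>linear_extensions d r. card (step_chains (descent d \<omega> \<sigma>) d k))"
proof -
  have w: "\<omega> permutes {1..d}" using \<omega> by (simp add: natural_labelling_def)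
  have le: "\<sigma> permutes {1..d}" if "\<sigma> \<in> linear_extensions d r" for \<sigma>
    using that by (simp add: linear_extensions_def)
  have "order_maps d r k = (\<Union>\<sigma>\<in>linear_extensions d r. sorted_maps d \<omega> k \<sigma>)"
  proof
    show "order_maps d r k \<subseteq> (\<Union>\<sigma>\<in>linear_extensions d r. sorted_maps d \<omega> k \<sigma>)"
    proof
      fix f assume f: "f \<in> order_maps d r k"
      then have "f \<in> {1..d} \<rightarrow>\<^sub>E {0..k}" by (simp add: order_maps_def)
      from ex1_sorted_maps[OF w this] obtain \<sigma>
        where "\<sigma> permutes {1..d}" "f \<in> sorted_maps d \<omega> k \<sigma>" by blast
      then show "f \<in> (\<Union>\<sigma>\<in>linear_extensions d r. sorted_maps d \<omega> k \<sigma>)"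
        using sorting_permutation_is_linear_extension[OF r \<omega> f] by blast
    qed
  qed (use sorted_maps_subset_order_maps[OF r] in blast)
  also have "card \<dots> = (\<Sum>\<sigma>\<in>linear_extensions d r. card (sorted_maps d \<omega> k \<sigma>))"
  proof (rule card_UN_disjoint)
    show "\<forall>\<sigma>\<in>linear_extensions d r. finite (sorted_maps d \<omega> k \<sigma>)"
      unfolding sorted_maps_def by (auto intro!: finite_subset[OF _ finite_PiE[of "{1..d}" "\<lambda>_. {0..k}"]])
    show "\<forall>\<sigma>\<in>linear_extensions d r. \<forall>\<tau>\<in>linear_extensions d r.
        \<sigma> \<noteq> \<tau> \<longrightarrow> sorted_maps d \<omega> k \<sigma> \<inter> sorted_maps d \<omega> k \<tau> = {}"
    proof (intro ballI impI, rule ccontr)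
      fix \<sigma> \<tau> assume st: "\<sigma> \<in> linear_extensions d r" "\<tau> \<in> linear_extensions d r" "\<sigma> \<noteq> \<tau>"
        and "sorted_maps d \<omega> k \<sigma> \<inter> sorted_maps d \<omega> k \<tau> \<noteq> {}"
      then obtain f where f: "f \<in> sorted_maps d \<omega> k \<sigma>" "f \<in> sorted_maps d \<omega> k \<tau>" by blast
      then have "f \<in> {1..d} \<rightarrow>\<^sub>E {0..k}" by (simp add: sorted_maps_def)
      from ex1_sorted_maps[OF w this] f st le show False by blast
    qed
  qed (rule finite_linear_extensions)
  also have "\<dots> = (\<Sum>\<sigma>\<in>linear_extensions d r. card (step_chains (descent d \<omega> \<sigma>) d k))"
    by (intro sum.cong refl card_sorted_maps le)
  finally show ?thesis .
qed

section \<open>The Ehrhart series of an order polytope\<close>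

lemma card_lattice_points:
  assumes k: "k \<ge> 1" and r: "r \<subseteq> {1..d} \<times> {1..d}"
  shows "card (dilate d k (order_polytope d r) \<inter> ({1..d} \<rightarrow>\<^sub>E \<int>)) = card (order_maps d r k)"
proof -
  let ?e = "\<lambda>f::nat \<Rightarrow> nat. \<lambda>i\<in>{1..d}. real (f i)"
  have "inj_on ?e (order_maps d r k)"
  proof (rule inj_onI)
    fix f g assume fg: "f \<in> order_maps d r k" "g \<in> order_maps d r k" "?e f = ?e g"
    have "f i = g i" if "i \<in> {1..d}" for i
      using fun_cong[OF fg(3), of i] that by simp
    then show "f = g" using fg(1,2) unfolding order_maps_def by (blast intro: PiE_ext)
  qed
  moreover have "?e ` order_maps d r k = dilate d k (order_polytope d r) \<inter> ({1..d} \<rightarrow>\<^sub>E \<int>)"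
  proof (intro equalityI subsetI)
    fix y assume "y \<in> ?e ` order_maps d r k"
    then obtain f where f: "f \<in> order_maps d r k" and y: "y = ?e f" by blast
    define x where "x = (\<lambda>i\<in>{1..d}. real (f i) / real k)"
    have "x \<in> order_polytope d r"
      using f k r unfolding order_polytope_def order_maps_def x_def
      by (auto simp: divide_right_mono subset_iff PiE_def Pi_def)
    moreover have "y = (\<lambda>i\<in>{1..d}. real k * x i)" using k by (auto simp: y x_def)
    ultimately have "y \<in> dilate d k (order_polytope d r)" unfolding dilate_def by blast
    moreover have "y \<in> {1..d} \<rightarrow>\<^sub>E \<int>" by (simp add: y)
    ultimately show "y \<in> dilate d k (order_polytope d r) \<inter> ({1..d} \<rightarrow>\<^sub>E \<int>)" by blast
  next
    fix y assume yy: "y \<in> dilate d k (order_polytope d r) \<inter> ({1..d} \<rightarrow>\<^sub>E \<int>)"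
    then obtain x where x: "x \<in> order_polytope d r" and y: "y = (\<lambda>i\<in>{1..d}. real k * x i)"
      by (auto simp: dilate_def)
    have x01: "0 \<le> x i" "x i \<le> 1" if "i \<in> {1..d}" for i
      using x that by (auto simp: order_polytope_def PiE_def Pi_def)
    define f where "f = (\<lambda>i\<in>{1..d}. nat \<lfloor>y i\<rfloor>)"
    have fy: "real (f i) = y i" if i: "i \<in> {1..d}" for i
    proof -
      have "y i \<in> \<int>" using yy i by auto
      moreover have "0 \<le> y i" using x01[OF i] i by (simp add: y)
      ultimately show ?thesis using i by (auto simp: f_def elim!: Ints_cases)
    qed
    have "f i \<le> k" if i: "i \<in> {1..d}" for i
    proof -
      have "real (f i) \<le> real k" using fy[OF i] x01[OF i] i by (auto simp: y mult_left_le)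
      then show ?thesis by simp
    qed
    moreover have "f i \<le> f j" if ij: "(i, j) \<in> r" for i j
    proof -
      have "i \<in> {1..d}" "j \<in> {1..d}" using ij r by auto
      moreover have "x i \<le> x j" using x ij by (auto simp: order_polytope_def)
      ultimately have "real (f i) \<le> real (f j)" by (simp add: fy y mult_left_mono)
      then show ?thesis by simp
    qed
    moreover have "f \<in> extensional {1..d}" by (simp add: f_def)
    ultimately have "f \<in> order_maps d r k" unfolding order_maps_def PiE_def Pi_def by auto
    moreover have "y = ?e f" using fy by (auto simp: y)
    ultimately show "y \<in> ?e ` order_maps d r k" by blast
  qed
  ultimately show ?thesis by (metis card_image)
qed

text \<open>
  The Ehrhart series has constant term \<open>1\<close> by convention; this agrees with the general count.
\<close>

lemma card_order_maps_0:
  assumes "r \<subseteq> {1..d} \<times> {1..d}"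
  shows "card (order_maps d r 0) = 1"
proof -
  have "order_maps d r 0 = {\<lambda>i\<in>{1..d}. 0}"
    using assms by (auto simp: order_maps_def PiE_def Pi_def extensional_def subset_iff fun_eq_iff)
  then show ?thesis by simp
qed

text \<open>
  Each linear extension contributes the series of the chains whose strict steps are its descents.
\<close>

theorem ehrhart_series_order_polytope:
  assumes r: "r \<subseteq> {1..d} \<times> {1..d}" and \<omega>: "natural_labelling d r \<omega>"
  shows "(1 - fps_X) ^ (d + 1) * ehrhart_series d (order_polytope d r) =
    (\<Sum>\<sigma>\<in>linear_extensions d r. fps_X ^ card {i. descent d \<omega> \<sigma> i})"
proof -
  have "ehrhart_series d (order_polytope d r) = Abs_fps (\<lambda>k. real (card (order_maps d r k)))"
  proof (rule fps_ext)
    fix k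
    show "fps_nth (ehrhart_series d (order_polytope d r)) k =
        fps_nth (Abs_fps (\<lambda>k. real (card (order_maps d r k)))) k"
      using card_lattice_points[of k, OF _ r] card_order_maps_0[OF r]
      by (cases k) (simp_all add: ehrhart_series_def)
  qed
  also have "\<dots> = (\<Sum>\<sigma>\<in>linear_extensions d r. chain_series (descent d \<omega> \<sigma>) d)"
    by (rule fps_ext) (simp add: card_order_maps[OF r \<omega>] chain_series_def fps_sum_nth)
  finally have "(1 - fps_X) ^ (d + 1) * ehrhart_series d (order_polytope d r) =
      (\<Sum>\<sigma>\<in>linear_extensions d r. (1 - fps_X) ^ (d + 1) * chain_series (descent d \<omega> \<sigma>) d)"
    by (simp only: sum_distrib_left)
  also have "\<dots> = (\<Sum>\<sigma>\<in>linear_extensions d r. fps_X ^ card {i. descent d \<omega> \<sigma> i})"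
  proof (rule sum.cong[OF refl])
    fix \<sigma>
    have "{i \<in> {1..<d}. descent d \<omega> \<sigma> i} = {i. descent d \<omega> \<sigma> i}" by (auto simp: descent_def)
    with chain_series_eq[of "descent d \<omega> \<sigma>" d]
    show "(1 - fps_X) ^ (d + 1) * chain_series (descent d \<omega> \<sigma>) d = fps_X ^ card {i. descent d \<omega> \<sigma> i}"
      by (simp add: descent_def)
  qed
  finally show ?thesis .
qed

text \<open>
  As \<open>1 - X\<close> is invertible among power series, the defining equation of the \<open>h\<^sup>*\<close>-polynomial has
  at most one solution, so it suffices to exhibit one.
\<close>

lemma hstar_eqI:
  assumes "degree h \<le> d" and eq: "(1 - fps_X) ^ (d + 1) * ehrhart_series d p = fps_of_poly h"
  shows "hstar d p = h"
proof -
  have nz: "fps_nth ((1 - fps_X :: real fps) ^ (d + 1)) 0 \<noteq> 0" by (simp add: fps_nth_power_0)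
  have iff: "ehrhart_series d p = fps_of_poly g / (1 - fps_X) ^ (d + 1) \<longleftrightarrow>
      (1 - fps_X) ^ (d + 1) * ehrhart_series d p = fps_of_poly g" for g
  proof -
    let ?P = "(1 - fps_X :: real fps) ^ (d + 1)" and ?E = "ehrhart_series d p"
    have u: "inverse ?P * ?P = 1" by (rule inverse_mult_eq_1[OF nz])
    show ?thesis unfolding fps_divide_unit[OF nz]
    proof
      assume E: "?E = fps_of_poly g * inverse ?P"
      have "?P * ?E = (inverse ?P * ?P) * fps_of_poly g" unfolding E by (simp only: mult_ac)
      then show "?P * ?E = fps_of_poly g" by (simp only: u mult_1)
    next
      assume g: "?P * ?E = fps_of_poly g"
      have "(inverse ?P * ?P) * ?E = fps_of_poly g * inverse ?P" unfolding g[symmetric] by (simp only: mult_ac)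
      then show "?E = fps_of_poly g * inverse ?P" by (simp only: u mult_1)
    qed
  qed
  show ?thesis unfolding hstar_def iff eq
    using assms(1) by (intro the_equality) (auto simp: fps_of_poly_eq_iff)
qed

theorem hstar_order_polytope:
  assumes r: "r \<subseteq> {1..d} \<times> {1..d}" and \<omega>: "natural_labelling d r \<omega>"
  shows "hstar d (order_polytope d r) =
    (\<Sum>\<sigma>\<in>linear_extensions d r. monom 1 (card {i. descent d \<omega> \<sigma> i}))"
proof (rule hstar_eqI)
  have "card {i. descent d \<omega> \<sigma> i} \<le> d" for \<sigma>
  proof -
    have "card {i. descent d \<omega> \<sigma> i} \<le> card {1..<d}"
      by (rule card_mono) (auto simp: descent_def)
    then show ?thesis by simp
  qed
  then show "degree (\<Sum>\<sigma>\<in>linear_extensions d r. monom (1::real) (card {i. descent d \<omega> \<sigma> i})) \<le> d"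
    by (intro degree_sum_le finite_linear_extensions order_trans[OF degree_monom_le])
  show "(1 - fps_X) ^ (d + 1) * ehrhart_series d (order_polytope d r) =
      fps_of_poly (\<Sum>\<sigma>\<in>linear_extensions d r. monom 1 (card {i. descent d \<omega> \<sigma> i}))"
    by (simp only: ehrhart_series_order_polytope[OF assms] fps_of_poly_sum fps_of_poly_monom') 
qed

section \<open>The crown poset\<close>

text \<open>
  The values, listed along the cycle \<open>1, 2, \<dots>, 2n\<close>, are \<open>1, 3, 2, 5, 4, \<dots>, 2n - 1, 2n - 2, 2n\<close>: every
  minimal element other than \<open>1\<close> moves below the maximal element preceding it.
\<close>

definition crown_labelling :: "nat \<Rightarrow> nat \<Rightarrow> nat" where
  "crown_labelling n a =
     (if even a \<and> 2 \<le> a \<and> a < 2 * n then a + 1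
      else if odd a \<and> 2 < a \<and> a < 2 * n then a - 1 else a)"

lemma crown_covers_bounds:
  assumes "n \<ge> 1"
  shows "crown_covers n \<subseteq> {1..2 * n} \<times> {1..2 * n}"
  using assms by (auto simp: crown_covers_def)

lemma crown_order_bounds:
  assumes "n \<ge> 1"
  shows "crown_order n \<subseteq> {1..2 * n} \<times> {1..2 * n}"
  using trancl_subset_Sigma[OF crown_covers_bounds[OF assms]]
  by (auto simp: crown_order_def)

lemma crown_order_monotone_iff:
  "(\<forall>(i, j) \<in> crown_order n. \<phi> i \<le> \<phi> j) \<longleftrightarrow> (\<forall>(i, j) \<in> crown_covers n. \<phi> i \<le> (\<phi> j :: nat))"
proof
  assume le: "\<forall>(i, j) \<in> crown_order n. \<phi> i \<le> \<phi> j"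
  have "\<phi> i \<le> \<phi> j" if "(i, j) \<in> crown_covers n" for i j
  proof -
    have "(i, j) \<in> crown_order n" using that by (simp add: crown_order_def r_into_trancl)
    from bspec[OF le this] show ?thesis by simp
  qed
  then show "\<forall>(i, j) \<in> crown_covers n. \<phi> i \<le> \<phi> j" by (intro ballI case_prodI2) simp
next
  assume le: "\<forall>(i, j) \<in> crown_covers n. \<phi> i \<le> \<phi> j"
  have "\<phi> i \<le> \<phi> j" if "(i, j) \<in> (crown_covers n)\<^sup>+" for i j
    using that by (induction rule: trancl_induct) (use le in force)+
  then have "\<phi> i \<le> \<phi> j" if "(i, j) \<in> crown_order n" for i j
    using that unfolding crown_order_def by (elim UnE) auto
  then show "\<forall>(i, j) \<in> crown_order n. \<phi> i \<le> \<phi> j" by (intro ballI case_prodI2) simp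
qed

lemma crown_labelling_involution: "crown_labelling n (crown_labelling n a) = a"
  unfolding crown_labelling_def by (auto; presburger)

text \<open>
  The labelling moves each element by at most one, so it keeps the order of distant elements weakly,
  and strictly by injectivity.
\<close>

lemma crown_labelling_less:
  assumes "b + 1 < a"
  shows "crown_labelling n b < crown_labelling n a"
proof -
  have "crown_labelling n b \<le> b + 1" "a \<le> crown_labelling n a + 1"
    by (auto simp: crown_labelling_def)
  moreover have "crown_labelling n b \<noteq> crown_labelling n a"
    using crown_labelling_involution[of n a] crown_labelling_involution[of n b] assms by auto
  ultimately show ?thesis using assms by linarith
qed

lemma crown_labelling_natural:
  assumes "n \<ge> 1"
  shows "natural_labelling (2 * n) (crown_order n) (crown_labelling n)"
proof -
  have "crown_labelling n permutes {1..2 * n}"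
    unfolding permutes_def
    by (metis atLeastAtMost_iff crown_labelling_def crown_labelling_involution less_imp_le_nat le_trans one_le_numeral)
  moreover have "\<forall>(i, j) \<in> crown_covers n. crown_labelling n i \<le> crown_labelling n j"
    using assms unfolding crown_covers_def crown_labelling_def by auto
  ultimately show ?thesis by (simp add: natural_labelling_def crown_order_monotone_iff)
qed

text \<open>
  The strict inequalities of cyclic alternation follow from the weak ones along the covers, since
  the two ends of a cover are distinct and a permutation is injective.
\<close>

lemma linear_extensions_crown:
  assumes "n \<ge> 1"
  shows "linear_extensions (2 * n) (crown_order n) = cyc_alternating n"
proof -
  have "(\<forall>(i, j) \<in> crown_covers n. \<sigma> i \<le> \<sigma> j) \<longleftrightarrow>
     (\<forall>k\<in>{1..n}. \<sigma> (2 * k - 1) < \<sigma> (2 * k)) \<and>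
     (\<forall>k\<in>{1..<n}. \<sigma> (2 * k) > \<sigma> (2 * k + 1)) \<and> \<sigma> (2 * n) > \<sigma> 1"
    if \<sigma>: "\<sigma> permutes {1..2 * n}" for \<sigma> :: "nat \<Rightarrow> nat"
  proof -
    have neq: "\<sigma> i < \<sigma> j \<longleftrightarrow> \<sigma> i \<le> \<sigma> j" if "i \<noteq> j" for i j
      using permutes_inj[OF \<sigma>] that by (metis injD order_le_less)
    have "\<sigma> (2 * k - 1) < \<sigma> (2 * k) \<longleftrightarrow> \<sigma> (2 * k - 1) \<le> \<sigma> (2 * k)" if "k \<in> {1..n}" for k
      using that by (intro neq) auto
    moreover have "\<sigma> (2 * k + 1) < \<sigma> (2 * k) \<longleftrightarrow> \<sigma> (2 * k + 1) \<le> \<sigma> (2 * k)" for k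
      by (intro neq) auto
    moreover have "\<sigma> 1 < \<sigma> (2 * n) \<longleftrightarrow> \<sigma> 1 \<le> \<sigma> (2 * n)"
      by (intro neq) presburger
    ultimately show ?thesis unfolding crown_covers_def by blast
  qed
  then show ?thesis
    unfolding linear_extensions_def cyc_alternating_def crown_order_monotone_iff by blast
qed

text \<open>
  Let \<open>a\<close> and \<open>b\<close> occupy the places \<open>i\<close> and \<open>i + 1\<close> of \<open>\<sigma>\<close>. At distance two or more, labels
  compare like the elements themselves. At distance one, alternation forbids that \<open>a\<close> is even, for it
  would then be a peak placed below its neighbour \<open>b\<close>.
\<close>

lemma cswap_eq_descents:
  assumes \<sigma>: "\<sigma> \<in> cyc_alternating n"
  shows "cswap n \<sigma> = card {i. descent (2 * n) (crown_labelling n) \<sigma> i}"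
proof -
  have p: "\<sigma> permutes {1..2 * n}" using \<sigma> by (simp add: cyc_alternating_def)
  have "inv \<sigma> i > inv \<sigma> (i + 1) + 1 \<longleftrightarrow>
      crown_labelling n (inv \<sigma> (Suc i)) < crown_labelling n (inv \<sigma> i)"
    if i: "i \<in> {1..<2 * n}" for i
  proof -
    define a b where "a = inv \<sigma> i" and "b = inv \<sigma> (Suc i)"
    have ab: "a \<in> {1..2 * n}" "b \<in> {1..2 * n}"
      using permutes_in_image[OF permutes_inv[OF p]] i unfolding a_def b_def by auto
    have less: "\<sigma> a < \<sigma> b" using permutes_inverses(1)[OF p] by (simp add: a_def b_def)
    then have "a \<noteq> b" by auto
    have left: "b + 1 \<noteq> a" if ev: "even a"
    proof
      assume "b + 1 = a"
      moreover obtain k where "a = 2 * k" using ev by (rule evenE)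
      ultimately have "a = 2 * k" "b = 2 * k - 1" by simp_all
      with less \<sigma> ab show False by (force simp: cyc_alternating_def)
    qed
    have right: "a + 1 \<noteq> b" if ev: "even a"
    proof
      assume "a + 1 = b"
      moreover obtain k where "a = 2 * k" using ev by (rule evenE)
      ultimately have "a = 2 * k" "b = 2 * k + 1" by simp_all
      with less \<sigma> ab show False by (force simp: cyc_alternating_def)
    qed
    have "b + 1 < a \<longleftrightarrow> crown_labelling n b < crown_labelling n a"
    proof -
      consider "b + 1 < a" | "a + 1 < b" | "a = b + 1" | "b = a + 1" using \<open>a \<noteq> b\<close> by linarith
      then show ?thesis
      proof cases
        case 1
        then show ?thesis using crown_labelling_less by blast
      next
        case 2
        then show ?thesis using crown_labelling_less[of a b n] by simp
      next
        case 3
        then have "even b" using left by auto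
        moreover from this have "2 \<le> b" "b < 2 * n" using ab 3 by (auto elim!: evenE)
        ultimately show ?thesis using 3 by (simp add: crown_labelling_def)
      next
        case 4
        then have "odd a" using right by auto
        then have "crown_labelling n a \<le> a" "b \<le> crown_labelling n b"
          using 4 by (simp_all add: crown_labelling_def)
        then show ?thesis using 4 by simp
      qed
    qed
    then show ?thesis by (simp add: a_def b_def)
  qed
  then show ?thesis unfolding cswap_def descent_def by (metis (no_types, lifting))
qed

theorem theorem5p11:
  fixes n :: nat
  assumes "n \<ge> 1"
  shows "hstar (2 * n) (order_polytope (2 * n) (crown_order n)) =
         (\<Sum>\<sigma>\<in>cyc_alternating n. monom 1 (cswap n \<sigma>))"
proof -
  have "hstar (2 * n) (order_polytope (2 * n) (crown_order n)) =
      (\<Sum>\<sigma>\<in>linear_extensions (2 * n) (crown_order n).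
         monom 1 (card {i. descent (2 * n) (crown_labelling n) \<sigma> i}))"
    by (rule hstar_order_polytope[OF crown_order_bounds crown_labelling_natural]) (use assms in simp_all)
  also have "\<dots> = (\<Sum>\<sigma>\<in>cyc_alternating n. monom 1 (cswap n \<sigma>))"
    unfolding linear_extensions_crown[OF assms]
    by (rule sum.cong) (simp_all add: cswap_eq_descents)
  finally show ?thesis .
qed

end
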